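(* Let $h>0$ and let $E\subset\mathbb{R}^2$ be a Jordan domain with curvature bounded from above by $h$ in the viscosity sense (at every point of $\partial E$). Then $E$ contains a ball of radius $1/h$.
   Context: A Jordan domain is the bounded open region enclosed by a Jordan curve (a homeomorphic image of the circle) in the plane. Balls $B_r(y)$ are open balls. A set $E\subset\mathbb{R}^2$ has curvature bounded above by $h$ at $x\in\partial E$ in the viscosity sense if the following holds: whenever $A$ is a circular arc that locally touches $E$ from outside at $x$, that is, $x$ is contained in the relative interior of $A\subset\partial B_r(y)$ and for some $\varepsilon>0$ one has $E\cap B_\varepsilon(x)\subset\overline{B}_r(y)$, then $r\ge 1/h$. $E$ has curvature bounded above by $h$ in the viscosity sense if this holds at every $x\in\partial E$. *)

theory Defs
  imports "HOL-Analysis.Analysis"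
begin

text \<open>By the Jordan curve theorem, the complement of a Jordan curve has exactly one bounded
  component, and \<^const>\<open>inside\<close> is the union of the bounded components.\<close>

definition Jordan_curve :: "(real^2) set \<Rightarrow> bool" where
  "Jordan_curve C \<longleftrightarrow> C homeomorphic sphere (0 :: real^2) 1"

definition Jordan_domain :: "(real^2) set \<Rightarrow> bool" where
  "Jordan_domain E \<longleftrightarrow> (\<exists>C. Jordan_curve C \<and> E = inside C)"

definition circular_arc :: "(real^2) set \<Rightarrow> real^2 \<Rightarrow> real \<Rightarrow> bool" where
  "circular_arc A y r \<longleftrightarrow> r > 0 \<and>
     (\<exists>a b. a < b \<and> b < a + 2 * pi \<and>
        A = (\<lambda>t. y + r *\<^sub>R vector [cos t, sin t]) ` {a..b})"

text \<open>The relative interior of an arc is its interior as a subset of the circle carrying it, i.e.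
  the arc without its endpoints. (The convex-geometric \<^const>\<open>rel_interior\<close>, which is
  relative to the affine hull, would be empty here.)\<close>

definition arc_touches_from_outside ::
    "(real^2) set \<Rightarrow> real^2 \<Rightarrow> real \<Rightarrow> (real^2) set \<Rightarrow> real^2 \<Rightarrow> bool" where
  "arc_touches_from_outside A y r E x \<longleftrightarrow>
     circular_arc A y r \<and>
     x \<in> top_of_set (sphere y r) interior_of A \<and>
     (\<exists>\<epsilon>>0. E \<inter> ball x \<epsilon> \<subseteq> cball y r)"

definition visc_curvature_le_at :: "(real^2) set \<Rightarrow> real \<Rightarrow> real^2 \<Rightarrow> bool" where
  "visc_curvature_le_at E h x \<longleftrightarrow>
     (\<forall>A y r. arc_touches_from_outside A y r E x \<longrightarrow> r \<ge> 1 / h)"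

definition visc_curvature_le :: "(real^2) set \<Rightarrow> real \<Rightarrow> bool" where
  "visc_curvature_le E h \<longleftrightarrow> (\<forall>x\<in>frontier E. visc_curvature_le_at E h x)"

end

theory Submission imports Defs begin

text \<open>
  Let \<open>R = 1 / h\<close>, let \<open>g\<close> be a simple closed parametrization of the boundary curve, and suppose that
  no disc of radius \<open>R\<close> fits into the domain. The classical argument of Pestov and Ionin follows the
  medial axis to a leaf, where a disc osculates the curve. For a curve without any smoothness,
  the leaf is replaced by a compactness argument about the branches of the medial axis.

  A point \<open>z\<close> of the domain is bitangent at the parameters \<open>a < b\<close> if the largest disc around \<open>z\<close>
  inside the domain touches the curve at \<open>g a\<close> and at \<open>g b\<close>. The two radii to these feet, the spokes,
  cut the domain in two, and the pocket is the part bounded by the spokes and the arc \<open>g ` {a..b}\<close>.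
  Bitangent points exist (\<open>ex_bitangent\<close>): otherwise the nearest-point map would retract the closed
  domain onto its boundary. Two facts about them exclude each other.

  The parameter length \<open>b - a\<close> is bounded below. Enlarge the disc around \<open>z\<close> until it contains the
  pocket. Its circle then meets the arc at a point strictly between the feet, and there the domain
  agrees locally with the pocket, so the disc touches the domain from outside (\<open>touching_disc\<close>). By the
  curvature bound its radius is at least \<open>R\<close>. The feet are closer to \<open>z\<close> than \<open>R\<close>, by a
  margin that is the same for all \<open>z\<close>. Hence the arc has a diameter bounded below, and by uniform
  continuity of \<open>g\<close> so is \<open>b - a\<close>. Compactness now gives a bitangent point with \<open>b - a\<close> minimal.

  But \<open>b - a\<close> is never minimal (\<open>bitangent_not_minimal\<close>). Each point of the closed pocket has a
  nearest curve point on the arc. If \<open>b - a\<close> were minimal, this nearest point would be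
  unique except that it could be both feet at once. Wrapping \<open>{a..b}\<close> once around the circle, which
  identifies \<open>a\<close> and \<open>b\<close>, turns the nearest-point relation into a continuous map from the closed
  pocket to the circle. Along the boundary of the pocket this map runs once around the circle while the
  arc is traversed and rests while the spokes are. So it is homotopic there to a homeomorphism onto
  the circle, and extending the homotopy over the closed pocket (Borsuk) retracts the pocket
  onto its boundary, which is impossible (\<open>no_extension_near_parametrization\<close>).

  The argument runs in the complex plane and is transported to \<open>real^2\<close> by a linear isometry.
\<close>

section \<open>Circle-valued maps on the closure of a Jordan domain\<close>

text \<open>A continuous surjection from a compact space to a Hausdorff space is a quotient map. This turns
  relations with compact graph, such as "nearest point", into continuous functions, and
  it inverts parametrizations of closed curves.\<close>

lemma continuous_factor_through_compact:
  fixes p :: "'a::topological_space \<Rightarrow> 'b::t2_space" and f :: "'a \<Rightarrow> 'c::t2_space"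
  assumes K: "compact K" and p: "continuous_on K p" and f: "continuous_on K f"
    and fibres: "\<And>x y. x \<in> K \<Longrightarrow> y \<in> K \<Longrightarrow> p x = p y \<Longrightarrow> f x = f y"
  obtains h where "continuous_on (p ` K) h" and "\<And>x. x \<in> K \<Longrightarrow> h (p x) = f x"
proof
  define h where "h = (\<lambda>y. f (SOME x. x \<in> K \<and> p x = y))"
  show hp: "h (p x) = f x" if "x \<in> K" for x
    unfolding h_def by (rule someI2[of _ x]) (use that fibres in blast)+
  show "continuous_on (p ` K) h"
    unfolding continuous_on_closed_invariant
  proof (intro allI impI)
    fix B :: "'c set" assume "closed B"
    obtain A where A: "closed A" "A \<inter> K = f -` B \<inter> K"
      using f \<open>closed B\<close> unfolding continuous_on_closed_invariant by blast
    have "compact (A \<inter> K)"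
      using A K by (blast intro: closed_Int_compact)
    then have "closed (p ` (A \<inter> K))"
      using p by (intro compact_imp_closed compact_continuous_image) (auto intro: continuous_on_subset)
    moreover have "p ` (A \<inter> K) \<inter> p ` K = h -` B \<inter> p ` K"
      using A hp by auto
    ultimately show "\<exists>A. closed A \<and> A \<inter> p ` K = h -` B \<inter> p ` K" by blast
  qed
qed

text \<open>Two points of the unit circle are at distance 2 only if they are antipodal, which points at most a
  quarter turn apart are not.\<close>

lemma dist_cis_less_2:
  assumes "cos (u - v) \<ge> 0"
  shows "dist (cis u) (cis v) < 2"
proof -
  have "(dist (cis u) (cis v))\<^sup>2 = (cos u - cos v)\<^sup>2 + (sin u - sin v)\<^sup>2"
    by (simp add: dist_norm cmod_power2)
  also have "\<dots> = ((sin u)\<^sup>2 + (cos u)\<^sup>2) + ((sin v)\<^sup>2 + (cos v)\<^sup>2) - 2 * cos (u - v)"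
    by (simp only: cos_diff power2_eq_square ring_distribs) algebra
  also have "\<dots> < 2\<^sup>2"
    using assms by simp
  finally show ?thesis
    by (rule power2_less_imp_less) simp
qed

lemma cis_2pi_image: "(\<lambda>s. cis (2 * pi * s)) ` {0..1} = sphere 0 1"
  (is "?e ` _ = _")
proof
  show "sphere 0 1 \<subseteq> ?e ` {0..1}"
  proof
    fix w :: complex assume "w \<in> sphere 0 1"
    then have "w = ?e (Arg2pi w / (2*pi))"
      using complex_norm_eq_1_exp[of w] by (auto simp: cis_conv_exp)
    moreover have "Arg2pi w / (2*pi) \<in> {0..1}"
      using Arg2pi[of w] by (simp add: less_imp_le)
    ultimately show "w \<in> ?e ` {0..1}" by blast
  qed
qed auto

lemma cis_2pi_eq:
  assumes "s \<in> {0..1}" "t \<in> {0..1}" "cis (2 * pi * s) = cis (2 * pi * t)"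
  shows "s = t \<or> s = 0 \<and> t = 1 \<or> s = 1 \<and> t = 0"
proof -
  have "exp (\<i> * complex_of_real (2 * pi * s)) = exp (\<i> * complex_of_real (2 * pi * t))"
    using assms(3) by (simp add: cis_conv_exp)
  then obtain n :: int where "\<i> * complex_of_real (2 * pi * s) = 
      \<i> * complex_of_real (2 * pi * t) + (of_int (2 * n) * pi) * \<i>"
    unfolding exp_eq by blast
  then have "2 * pi * s = 2 * pi * t + of_int (2 * n) * pi"
    by (auto simp: complex_eq_iff)
  then have "pi * (2 * s) = pi * (2 * (t + of_int n))"
    by (simp add: algebra_simps)
  then have st: "s = t + of_int n"
    by simp
  with assms(1,2) have "\<bar>of_int n :: real\<bar> \<le> 1" by (auto simp: abs_le_iff)
  then have "n = -1 \<or> n = 0 \<or> n = 1" by linarith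
  with st assms(1,2) show ?thesis by (elim disjE) simp_all
qed

text \<open>A map from the closure of a Jordan domain to the circle cannot have degree one on the boundary
  curve. The hypothesis \<open>near\<close> expresses degree one without mentioning degrees: on the
  boundary, \<open>F\<close> is nowhere antipodal to the homeomorphism \<open>H\<close> with \<open>H (\<xi> s) = cis (2 * pi * s)\<close>, and
  hence is homotopic to it in the punctured plane. By Borsuk's homotopy extension theorem \<open>H\<close> then
  extends to the closed domain, and following the extension by the inverse of \<open>H\<close> gives a retraction
  onto the boundary.\<close>

lemma no_extension_near_parametrization:
  fixes \<xi> :: "real \<Rightarrow> complex"
  assumes simple: "simple_path \<xi>" and loop: "pathfinish \<xi> = pathstart \<xi>"
    and contF: "continuous_on (closure (inside (path_image \<xi>))) F"
    and normF: "\<And>w. w \<in> closure (inside (path_image \<xi>)) \<Longrightarrow> norm (F w) = 1"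
    and near: "\<And>s. s \<in> {0..1} \<Longrightarrow> dist (F (\<xi> s)) (cis (2 * pi * s)) < 2"
  shows False
proof -
  let ?S = "inside (path_image \<xi>)"
  let ?e = "\<lambda>s::real. cis (2 * pi * s)"
  have S: "?S \<noteq> {}" "open ?S" "bounded ?S" and front: "frontier ?S = path_image \<xi>"
    using Jordan_inside_outside[OF simple loop] by auto
  have cl: "closure ?S = ?S \<union> path_image \<xi>"
    using front by (simp add: closure_Un_frontier)
  have cont\<xi>: "continuous_on {0..1} \<xi>"
    using simple by (simp add: simple_path_def path_def)
  have conte: "continuous_on {0..1} ?e"
    by (intro continuous_intros)
  have \<xi>eq: "s = t \<or> s = 0 \<and> t = 1 \<or> s = 1 \<and> t = 0" 
    if "s \<in> {0..1}" "t \<in> {0..1}" "\<xi> s = \<xi> t" for s t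
    using simple that unfolding simple_path_def loop_free_def by blast
  have \<xi>01: "\<xi> 0 = \<xi> 1" using loop by (simp add: pathstart_def pathfinish_def)
  have e01: "?e 0 = ?e 1" by (auto simp: complex_eq_iff)
  obtain H where contH: "continuous_on (\<xi> ` {0..1}) H" and H: "\<And>s. s \<in> {0..1} \<Longrightarrow> H (\<xi> s) = ?e s"
    by (rule continuous_factor_through_compact[OF compact_Icc cont\<xi> conte])
       (use \<xi>eq e01 in \<open>fastforce+\<close>)
  obtain H' where contH': "continuous_on (?e ` {0..1}) H'" and H': "\<And>s. s \<in> {0..1} \<Longrightarrow> H' (?e s) = \<xi> s"
    by (rule continuous_factor_through_compact[OF compact_Icc conte cont\<xi>])
       (use cis_2pi_eq \<xi>01 in \<open>fastforce+\<close>)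
  have homot: "homotopic_with_canon (\<lambda>x. True) (path_image \<xi>) (- {0}) F H"
  proof (rule homotopic_with_linear)
    show "continuous_on (path_image \<xi>) F"
      using contF by (rule continuous_on_subset) (simp add: cl)
    show "continuous_on (path_image \<xi>) H"
      using contH by (simp add: path_image_def)
    fix x assume "x \<in> path_image \<xi>"
    then obtain s where s: "s \<in> {0..1}" "x = \<xi> s" by (auto simp: path_image_def)
    have "norm (F x) = 1" using normF \<open>x \<in> path_image \<xi>\<close> cl by blast
    moreover have "norm (H x) = 1" using s H by simp
    moreover have "dist (F x) (H x) < 2" using near s H by simp
    ultimately show "closed_segment (F x) (H x) \<subseteq> - {0}"
      by (auto simp: between_mem_segment[symmetric] between)
  qed
  have Fim: "F \<in> closure ?S \<rightarrow> - {0}"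
    using normF by force
  have anr: "ANR (- {0::complex})"
    by (intro ENR_imp_ANR open_imp_ENR) auto
  have clo: "closedin (top_of_set (closure ?S)) (path_image \<xi>)"
    using simple by (auto simp: cl closed_simple_path_image intro: closed_subset)
  obtain G where contG: "continuous_on (closure ?S) G" 
      and G0: "G ` closure ?S \<subseteq> - {0}" and GH: "\<And>x. x \<in> path_image \<xi> \<Longrightarrow> G x = H x"
    by (rule Borsuk_homotopy_extension_homotopic[OF clo disjI2[OF anr] contF Fim homot]) (rule that)
  have sgnG: "sgn (G x) \<in> ?e ` {0..1}" if "x \<in> closure ?S" for x
    unfolding cis_2pi_image using G0 that by (auto simp: norm_sgn)
  have "?S \<subseteq> path_image \<xi>"
  proof (rule frontier_subset_retraction)
    show "continuous_on (closure ?S) (\<lambda>x. H' (sgn (G x)))"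
    proof (rule continuous_on_compose2[OF contH'])
      show "continuous_on (closure ?S) (\<lambda>x. sgn (G x))"
        using G0 by (intro continuous_on_sgn contG) auto
    qed (use sgnG in blast)
    show "(\<lambda>x. H' (sgn (G x))) \<in> ?S \<rightarrow> path_image \<xi>"
    proof
      fix x assume "x \<in> ?S"
      then obtain s where "s \<in> {0..1}" "sgn (G x) = ?e s"
        using sgnG closure_subset by blast
      then show "H' (sgn (G x)) \<in> path_image \<xi>" using H' by (simp add: path_image_def)
    qed
    fix x assume "x \<in> path_image \<xi>"
    then obtain s where s: "s \<in> {0..1}" "x = \<xi> s" by (auto simp: path_image_def)
    then show "H' (sgn (G x)) = x"
      using GH H H' \<open>x \<in> path_image \<xi>\<close> by (simp add: sgn_div_norm)
  qed (use S front in auto)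
  moreover have "?S \<inter> path_image \<xi> = {}" by simp
  ultimately show False using S by blast
qed

section \<open>Bitangent points and their pockets\<close>

lemma closed_segments_equal_length_meet:
  fixes z p q :: "'a::real_normed_vector"
  assumes "dist z p = dist z q" "p \<noteq> q"
  shows "closed_segment z p \<inter> closed_segment z q = {z}"
proof -
  have "x = z" if x: "x \<in> closed_segment z p" "x \<in> closed_segment z q" for x
  proof -
    obtain u where u: "0 \<le> u" "x = z + u *\<^sub>R (p - z)"
      using x(1) by (auto simp: in_segment algebra_simps)
    obtain v where v: "0 \<le> v" "x = z + v *\<^sub>R (q - z)"
      using x(2) by (auto simp: in_segment algebra_simps)
    have "u * dist z p = dist z x"
      using u by (simp add: dist_norm norm_minus_commute)
    moreover have "v * dist z q = dist z x"
      using v by (simp add: dist_norm norm_minus_commute)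
    moreover have "dist z p \<noteq> 0" using assms by auto
    ultimately have "u = v" using assms(1) by (metis mult_right_cancel)
    then have "u *\<^sub>R (p - z) = u *\<^sub>R (q - z)" using u(2) v(2) by (metis add_left_cancel)
    then have "u = 0 \<or> p = q" by auto
    then show "x = z" using assms(2) u(2) by auto
  qed
  then show ?thesis by auto
qed

lemma inside_subset_convex:
  fixes S K :: "'a::{real_normed_vector, perfect_space} set"
  assumes "convex K" "S \<subseteq> K"
  shows "inside S \<subseteq> K"
proof -
  have "- K \<subseteq> outside S"
    using outside_mono[OF assms(2)] outside_convex[OF assms(1)] by simp
  then show ?thesis using inside_Int_outside[of S] by blast
qed

locale jordan_loop =
  fixes g :: "real \<Rightarrow> complex"
  assumes simple: "simple_path g" and loop: "pathfinish g = pathstart g"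
begin

abbreviation curve :: "complex set" where "curve \<equiv> path_image g"
abbreviation domain :: "complex set" where "domain \<equiv> inside curve"

lemma domain_bounded: "bounded domain"
  and domain_nonempty: "domain \<noteq> {}"
  and frontier_domain: "frontier domain = curve"
  using Jordan_inside_outside[OF simple loop] by auto

lemma closure_domain: "closure domain = domain \<union> curve"
  using frontier_domain by (simp add: closure_Un_frontier)

lemma curve_closed: "closed curve" and curve_nonempty: "curve \<noteq> {}"
  using simple by (auto simp: closed_simple_path_image)

lemma continuous_g: "continuous_on {0..1} g"
  using simple by (simp add: simple_path_def path_def)

lemma g_in_curve: "t \<in> {0..1} \<Longrightarrow> g t \<in> curve"
  by (simp add: path_image_def)

lemma g_inj:
  assumes "0 \<le> s" "s \<le> t" "t \<le> 1" "t - s < 1" "g s = g t"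
  shows "s = t"
proof -
  have "s = t \<or> s = 0 \<and> t = 1 \<or> s = 1 \<and> t = 0"
    using simple assms unfolding simple_path_def loop_free_def by auto
  then show ?thesis using assms by auto
qed

lemma ball_infdist_subset_domain:
  assumes "z \<in> domain"
  shows "ball z (infdist z curve) \<subseteq> domain"
proof (rule ccontr)
  assume "\<not> ?thesis"
  then have "ball z (infdist z curve) - domain \<noteq> {}" by auto
  then have "z \<in> ball z (infdist z curve)" by (auto intro: le_less_trans[OF zero_le_dist])
  then have "ball z (infdist z curve) \<inter> frontier domain \<noteq> {}"
    using assms \<open>ball z (infdist z curve) - domain \<noteq> {}\<close>
    by (intro connected_Int_frontier connected_ball) blast+
  then obtain x where "x \<in> curve" "dist z x < infdist z curve"
    by (auto simp: frontier_domain)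
  then show False using infdist_le[of x curve z] by simp
qed

lemma infdist_curve_pos: "z \<in> domain \<Longrightarrow> 0 < infdist z curve"
  by (metis infdist_pos_not_in_closed curve_closed curve_nonempty disjoint_iff inside_no_overlap)

text \<open>The condition \<open>b - a < 1\<close> ensures \<open>g a \<noteq> g b\<close>: it excludes only the pair of parameters \<open>0\<close>, \<open>1\<close> of the
  common endpoint of the loop.\<close>

definition bitangent :: "real \<Rightarrow> real \<Rightarrow> complex \<Rightarrow> bool" where
  "bitangent a b z \<longleftrightarrow> 0 \<le> a \<and> a < b \<and> b \<le> 1 \<and> b - a < 1 \<and> z \<in> domain \<and>
     dist z (g a) = infdist z curve \<and> dist z (g b) = infdist z curve"

text \<open>The polygonal crosscut of the domain that passes from one foot through \<open>z\<close> to the other.\<close>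

definition spokes :: "real \<Rightarrow> real \<Rightarrow> complex \<Rightarrow> complex set" where
  "spokes a b z = closed_segment z (g a) \<union> closed_segment z (g b)"

definition pocket :: "real \<Rightarrow> real \<Rightarrow> complex \<Rightarrow> complex set" where
  "pocket a b z = inside (g ` {a..b} \<union> spokes a b z)"

text \<open>If every point had a unique nearest point on the curve, the nearest-point map would be continuous
  and hence a retraction of the closed domain onto its frontier.\<close>

lemma ex_bitangent: "\<exists>a b z. bitangent a b z"
proof (rule ccontr)
  assume none: "\<nexists>a b z. bitangent a b z"
  define K where "K = {k \<in> closure domain \<times> curve. dist (fst k) (snd k) = infdist (fst k) curve}"
  have "compact (closure domain \<times> curve)"
    using domain_bounded simple
    by (intro compact_Times)
       (auto simp: compact_eq_bounded_closed closed_simple_path_image bounded_simple_path_image)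
  moreover have "closedin (top_of_set (closure domain \<times> curve)) K"
  proof -
    have "K = (closure domain \<times> curve) \<inter> (\<lambda>k. dist (fst k) (snd k) - infdist (fst k) curve) -` {0}"
      unfolding K_def by auto
    also have "closedin (top_of_set (closure domain \<times> curve)) \<dots>"
      by (intro continuous_closedin_preimage continuous_intros)
    finally show ?thesis .
  qed
  ultimately have "compact K" by (rule closedin_compact)
  have fst_K: "fst ` K = closure domain"
  proof -
    have "\<exists>x\<in>curve. dist w x = infdist w curve" for w
      using infdist_attains_inf[OF curve_closed curve_nonempty] by metis
    then show ?thesis unfolding K_def by force
  qed
  have unique: "x = y" if xy: "(w, x) \<in> K" "(w, y) \<in> K" for w x y
  proof (cases "w \<in> curve")
    case True
    then show ?thesis using that by (simp add: K_def)
  next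
    case False
    have same: "s = t \<or> g s = g t" if "0 \<le> s" "s \<le> t" "t \<le> 1"
      "dist w (g s) = infdist w curve" "dist w (g t) = infdist w curve" "w \<in> domain" for s t
    proof (cases "t - s < 1")
      case True
      then show ?thesis using none that unfolding bitangent_def by force
    next
      case False
      then have "s = 0" "t = 1" using that by auto
      then show ?thesis using loop by (simp add: pathstart_def pathfinish_def)
    qed
    have "w \<in> domain" using xy False by (auto simp: K_def closure_domain)
    obtain s t where st: "s \<in> {0..1}" "x = g s" "t \<in> {0..1}" "y = g t"
      using xy by (auto simp: K_def path_image_def)
    moreover have "dist w (g s) = infdist w curve" "dist w (g t) = infdist w curve"
      using xy st by (auto simp: K_def)
    ultimately show ?thesis
      using same[of s t] same[of t s] \<open>w \<in> domain\<close> linear[of s t] by auto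
  qed
  obtain h where conth: "continuous_on (fst ` K) h" and h: "\<And>k. k \<in> K \<Longrightarrow> h (fst k) = snd k"
  proof (rule continuous_factor_through_compact[OF \<open>compact K\<close>])
    show "snd k = snd l" if "k \<in> K" "l \<in> K" "fst k = fst l" for k l
      using that unique by (metis prod.collapse)
  qed (auto intro: continuous_intros)
  have "domain \<subseteq> curve"
  proof (rule frontier_subset_retraction)
    show "continuous_on (closure domain) h" using conth fst_K by simp
    show "h \<in> domain \<rightarrow> curve"
    proof
      fix w assume "w \<in> domain"
      then obtain k where "k \<in> K" "w = fst k"
        using fst_K closure_subset by blast
      then show "h w \<in> curve" using h[of k] by (auto simp: K_def)
    qed
    show "h x = x" if "x \<in> curve" for x
      using that h[of "(x, x)"] by (simp add: K_def closure_domain)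
  qed (auto simp: domain_bounded frontier_domain)
  then show False using domain_nonempty by (metis inf.absorb_iff2 inf_commute inside_no_overlap)
qed

context
  fixes a b z
  assumes bt: "bitangent a b z"
begin

lemma bitangentD: "0 \<le> a" "a < b" "b \<le> 1" "b - a < 1" "z \<in> domain"
    "dist z (g a) = infdist z curve" "dist z (g b) = infdist z curve"
  using bt by (auto simp: bitangent_def)

lemma feet_distinct: "g a \<noteq> g b"
  using g_inj[of a b] bitangentD by auto

lemma arc_subset_curve: "g ` {a..b} \<subseteq> curve"
  using bitangentD by (auto simp: path_image_def)

lemma spokes_subset_cball: "spokes a b z \<subseteq> cball z (infdist z curve)"
  using bitangentD infdist_nonneg[of z curve] unfolding spokes_def
  by (intro Un_least closed_segment_subset) auto

lemma spokes_Int_curve: "spokes a b z \<inter> curve = {g a, g b}"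
proof -
  have "x = p" if "x \<in> closed_segment z p" "x \<in> curve" "dist z p = infdist z curve" for x p
  proof -
    have "dist z p = dist z x + dist x p"
      using that(1) by (simp add: between_mem_segment[symmetric] between)
    moreover have "infdist z curve \<le> dist z x" using that(2) by (rule infdist_le)
    ultimately have "dist x p = 0" using that(3) zero_le_dist[of x p] by linarith
    then show ?thesis by simp
  qed
  moreover have "g a \<in> curve" "g b \<in> curve"
    using bitangentD by (auto intro: g_in_curve)
  ultimately show ?thesis
    using bitangentD unfolding spokes_def by auto
qed

text \<open>The boundary of the pocket as a loop whose first half runs along the arc and whose second half
  returns along the spokes.\<close>

definition rim :: "real \<Rightarrow> complex" where
  "rim = subpath a b g +++ (linepath (g b) z +++ linepath z (g a))"

lemma path_image_spokes_path: "path_image (linepath (g b) z +++ linepath z (g a)) = spokes a b z"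
  by (auto simp: path_image_join spokes_def closed_segment_commute)

lemma arc_spokes_path: "arc (linepath (g b) z +++ linepath z (g a))"
proof (rule arc_join)
  have "g a \<noteq> z" "g b \<noteq> z"
    using bitangentD infdist_curve_pos by force+
  then show "arc (linepath (g b) z)" "arc (linepath z (g a))" by auto
  have "closed_segment z (g b) \<inter> closed_segment z (g a) = {z}"
    using bitangentD feet_distinct by (intro closed_segments_equal_length_meet) auto
  then show "path_image (linepath (g b) z) \<inter> path_image (linepath z (g a)) \<subseteq> {pathstart (linepath z (g a))}"
    by (simp add: closed_segment_commute)
qed simp

lemma arc_subpath_g: "arc (subpath a b g)"
  using bitangentD feet_distinct by (intro arc_simple_path_subpath simple) auto

lemma path_image_subpath_g: "path_image (subpath a b g) = g ` {a..b}"
  using bitangentD by (simp add: path_image_subpath)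

lemma simple_rim: "simple_path rim" and loop_rim: "pathfinish rim = pathstart rim"
  and path_image_rim: "path_image rim = g ` {a..b} \<union> spokes a b z"
proof -
  have "path_image (subpath a b g) \<inter> spokes a b z \<subseteq> {g a, g b}"
    using spokes_Int_curve arc_subset_curve path_image_subpath_g by blast
  then show "simple_path rim"
    unfolding rim_def using arc_subpath_g arc_spokes_path
    by (intro simple_path_join_loop) (auto simp: path_image_spokes_path)
  show "pathfinish rim = pathstart rim" by (simp add: rim_def)
  have "path_image rim = path_image (subpath a b g) \<union> path_image (linepath (g b) z +++ linepath z (g a))"
    unfolding rim_def by (rule path_image_join) simp
  then show "path_image rim = g ` {a..b} \<union> spokes a b z"
    by (simp only: path_image_spokes_path path_image_subpath_g)
qed

lemma pocket_eq_inside_rim: "pocket a b z = inside (path_image rim)"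
  by (simp add: pocket_def path_image_rim)

lemma frontier_pocket: "frontier (pocket a b z) = g ` {a..b} \<union> spokes a b z"
  using Jordan_inside_outside[OF simple_rim loop_rim] by (simp add: pocket_eq_inside_rim path_image_rim)

lemma closure_pocket: "closure (pocket a b z) = pocket a b z \<union> g ` {a..b} \<union> spokes a b z"
  using frontier_pocket by (auto simp: closure_Un_frontier)

text \<open>The spokes, together with the arc and the rest \<open>D\<close> of the curve, form a theta curve. To have \<open>D\<close>
  as the image of a single simple path, the parametrization is rotated so as to start at \<open>g a\<close>.\<close>

lemma complementary_arc:
  obtains D where "closed D" "D \<union> g ` {a..b} = curve" "D \<inter> g ` {a..b} = {g a, g b}"
    "pocket a b z \<union> inside (D \<union> spokes a b z) \<union> (spokes a b z - {g a, g b}) = domain"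
proof -
  define k where "k = shiftpath a g"
  define c2 where "c2 = subpath 1 (b - a) k"
  define c where "c = reversepath (linepath (g b) z +++ linepath z (g a))"
  have simple_k: "simple_path k" and image_k: "path_image k = curve"
    unfolding k_def using simple loop bitangentD
    by (auto intro: simple_path_shiftpath simp: path_image_shiftpath)
  have k: "k x = g (a + x)" if "x \<in> {0..b - a}" for x
    using that bitangentD by (simp add: k_def shiftpath_def)
  have k1: "k 1 = g a"
    using bitangentD loop by (auto simp: k_def shiftpath_def pathstart_def pathfinish_def)
  have image_c1: "g ` {a..b} = k ` {0..b - a}"
  proof -
    have "{a..b} = (\<lambda>x. a + x) ` {0..b - a}" by simp
    then show ?thesis using k by (simp only: image_image) (auto intro!: image_cong)
  qed
  have image_c2: "path_image c2 = k ` {b - a..1}"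
    using bitangentD by (simp add: c2_def path_image_subpath)
  have kb: "k (b - a) = g b" using k[of "b - a"] bitangentD by simp
  have ka: "k 0 = g a" using k[of 0] bitangentD by simp
  have un: "path_image c2 \<union> g ` {a..b} = curve"
  proof -
    have "{b - a..1} \<union> {0..b - a} = {0..1}" using bitangentD by auto
    moreover have "path_image c2 \<union> g ` {a..b} = k ` ({b - a..1} \<union> {0..b - a})"
      by (simp only: image_c1 image_c2 image_Un)
    ultimately show ?thesis using image_k by (simp only: path_image_def)
  qed
  have int: "path_image c2 \<inter> g ` {a..b} = {g a, g b}"
  proof
    show "path_image c2 \<inter> g ` {a..b} \<subseteq> {g a, g b}"
    proof
      fix x assume "x \<in> path_image c2 \<inter> g ` {a..b}"
      then obtain s t where st: "s \<in> {b - a..1}" "t \<in> {0..b - a}" "x = k s" "x = k t"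
        unfolding image_c1 image_c2 by auto
      moreover from st have "s \<in> {0..1}" "t \<in> {0..1}" using bitangentD by auto
      ultimately have "s = t \<or> s = 0 \<and> t = 1 \<or> s = 1 \<and> t = 0"
        using simple_k unfolding simple_path_def loop_free_def by metis
      then have "t = b - a \<or> t = 0" using st bitangentD by auto
      then show "x \<in> {g a, g b}" using st ka kb by auto
    qed
    have "g a \<in> k ` {b - a..1}" using k1 bitangentD by (auto intro!: image_eqI[of _ _ 1])
    moreover have "g b \<in> k ` {b - a..1}" using kb bitangentD by (auto intro!: image_eqI[of _ _ "b - a"])
    ultimately show "{g a, g b} \<subseteq> path_image c2 \<inter> g ` {a..b}"
      unfolding image_c2 using bitangentD by auto
  qed
  have image_c: "path_image c = spokes a b z"
    by (simp add: c_def path_image_spokes_path)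
  have "z \<in> spokes a b z" "z \<in> domain" by (auto simp: spokes_def bitangentD)
  obtain
    "inside (path_image (subpath a b g) \<union> path_image c) \<inter> inside (path_image c2 \<union> path_image c) = {}"
    "inside (path_image (subpath a b g) \<union> path_image c) \<union> inside (path_image c2 \<union> path_image c) \<union>
      (path_image c - {g a, g b}) = inside (path_image (subpath a b g) \<union> path_image c2)"
  proof (rule split_inside_simple_closed_curve)
    show "simple_path (subpath a b g)" using arc_subpath_g by (rule arc_imp_simple_path)
    show "simple_path c2"
      unfolding c2_def using simple_k bitangentD by (intro simple_path_subpath) auto
    show "simple_path c"
      unfolding c_def using arc_spokes_path by (intro simple_path_reversepath arc_imp_simple_path)
    show "path_image (subpath a b g) \<inter> path_image c2 = {g a, g b}"
      using int by (auto simp: path_image_subpath_g)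
    show "path_image (subpath a b g) \<inter> path_image c = {g a, g b}"
      unfolding image_c path_image_subpath_g
      using spokes_Int_curve arc_subset_curve bitangentD by auto
    show "path_image c2 \<inter> path_image c = {g a, g b}"
      unfolding image_c using spokes_Int_curve un int by auto
    show "path_image c \<inter> inside (path_image (subpath a b g) \<union> path_image c2) \<noteq> {}"
      using \<open>z \<in> spokes a b z\<close> \<open>z \<in> domain\<close> un by (auto simp: image_c path_image_subpath_g Un_commute)
  qed (auto simp: c2_def c_def k1 kb feet_distinct)
  moreover have "closed (path_image c2)"
    unfolding c2_def using simple_k bitangentD
    by (intro closed_path_image path_subpath) (auto simp: simple_path_def)
  ultimately show thesis
    using un int that by (simp add: image_c path_image_subpath_g pocket_def Un_commute)
qed

lemma pocket_subset_domain: "pocket a b z \<subseteq> domain"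
  using complementary_arc by (metis Un_upper1 le_sup_iff)

text \<open>The rest of the domain, on the far side of the spokes, stays away from the points of the arc
  that lie strictly between the feet.\<close>

lemma domain_near_arc_in_pocket:
  assumes "t \<in> {a<..<b}"
  obtains \<epsilon> where "0 < \<epsilon>" "domain \<inter> ball (g t) \<epsilon> \<subseteq> pocket a b z"
proof -
  obtain D where D: "closed D" "D \<union> g ` {a..b} = curve" "D \<inter> g ` {a..b} = {g a, g b}"
    "pocket a b z \<union> inside (D \<union> spokes a b z) \<union> (spokes a b z - {g a, g b}) = domain"
    by (rule complementary_arc)
  let ?X = "D \<union> spokes a b z \<union> inside (D \<union> spokes a b z)"
  have "closed (D \<union> spokes a b z)"
    using D(1) by (auto simp: spokes_def intro!: closed_Un)
  then have "closed ?X"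
    unfolding union_with_inside by (intro closed_Compl open_outside)
  moreover have "g t \<notin> ?X"
  proof -
    have gt: "g t \<in> curve" "g t \<in> g ` {a..b}" using assms bitangentD by (auto intro: g_in_curve)
    have "g t \<noteq> g a" "g t \<noteq> g b"
      using g_inj[of a t] g_inj[of t b] assms bitangentD by auto
    moreover have "g t \<notin> domain" using gt inside_no_overlap[of curve] by blast
    ultimately show ?thesis using gt D spokes_Int_curve by blast
  qed
  ultimately obtain \<epsilon> where \<epsilon>: "0 < \<epsilon>" "ball (g t) \<epsilon> \<subseteq> - ?X"
    by (meson ComplI open_Compl open_contains_ball)
  then have "domain \<inter> ball (g t) \<epsilon> \<subseteq> pocket a b z" using D by blast
  with \<epsilon>(1) show thesis by (rule that)
qed

text \<open>The disc around \<open>z\<close> through the point of the arc farthest from \<open>z\<close> contains the arc and the spokes,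
  and by convexity the pocket. That point can be taken strictly between the feet: the feet are
  nearest points of the curve, so if one of them is also farthest on the arc, the whole arc lies on
  one circle around \<open>z\<close> and any of its points will do.\<close>

lemma touching_disc:
  obtains t \<epsilon> where "t \<in> {a<..<b}" "0 < dist z (g t)" "0 < \<epsilon>" 
    "domain \<inter> ball (g t) \<epsilon> \<subseteq> cball z (dist z (g t))"
proof -
  have far: "infdist z curve \<le> dist z (g t)" if "t \<in> {a..b}" for t
    using that bitangentD by (intro infdist_le g_in_curve) auto
  obtain t where t: "t \<in> {a<..<b}" "\<And>s. s \<in> {a..b} \<Longrightarrow> dist z (g s) \<le> dist z (g t)"
  proof -
    have "continuous_on {a..b} (\<lambda>t. dist z (g t))"
      using bitangentD by (intro continuous_intros continuous_on_subset[OF continuous_g]) auto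
    then obtain t where t: "t \<in> {a..b}" "\<And>s. s \<in> {a..b} \<Longrightarrow> dist z (g s) \<le> dist z (g t)"
      using continuous_attains_sup[of "{a..b}" "\<lambda>t. dist z (g t)"] bitangentD by auto
    show thesis
    proof (cases "t \<in> {a<..<b}")
      case False
      then have "t = a \<or> t = b" using t by auto
      then have "dist z (g s) \<le> infdist z curve" if "s \<in> {a..b}" for s
        using t(2)[OF that] bitangentD by auto
      then show thesis
        using bitangentD far[of "(a + b) / 2"]
        by (intro that[of "(a + b) / 2"]) (auto intro: order_trans)
    qed (use t that in blast)
  qed
  have "pocket a b z \<subseteq> cball z (dist z (g t))"
    unfolding pocket_def
  proof (rule inside_subset_convex)
    show "g ` {a..b} \<union> spokes a b z \<subseteq> cball z (dist z (g t))"
      using t far[of t] spokes_subset_cball by fastforce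
  qed auto
  moreover obtain \<epsilon> where \<epsilon>: "0 < \<epsilon>" "domain \<inter> ball (g t) \<epsilon> \<subseteq> pocket a b z"
    by (rule domain_near_arc_in_pocket[OF t(1)])
  ultimately have "domain \<inter> ball (g t) \<epsilon> \<subseteq> cball z (dist z (g t))" by blast
  moreover have "infdist z curve \<le> dist z (g t)"
    by (rule far) (use t(1) in auto)
  then have "0 < dist z (g t)"
    using infdist_curve_pos[OF bitangentD(5)] by linarith
  ultimately show thesis using that[OF t(1)] \<epsilon>(1) by blast
qed

text \<open>The segment to a nearest point outside the arc leaves the pocket at some point \<open>c\<close> of the arc or of a
  spoke. In the first case \<open>c\<close> is at least as near. In the second, the foot of that spoke is at least as
  near to \<open>c\<close> as any other point of the curve, since the open disc around \<open>z\<close> through the foot contains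
  no curve point.\<close>

lemma nearest_point_on_arc:
  assumes "w \<in> closure (pocket a b z)"
  shows "\<exists>t\<in>{a..b}. dist w (g t) = infdist w curve"
    and "w \<in> closed_segment z (g a) \<Longrightarrow> dist w (g a) = infdist w curve"
    and "w \<in> closed_segment z (g b) \<Longrightarrow> dist w (g b) = infdist w curve"
proof -
  have foot: "dist c p \<le> dist c x"
    if "c \<in> closed_segment z p" "dist z p = infdist z curve" "x \<in> curve" for c p x
  proof -
    have "dist z p = dist z c + dist c p"
      using that(1) by (simp add: between_mem_segment[symmetric] between)
    moreover have "dist z p \<le> dist z x" using that infdist_le by metis
    ultimately show ?thesis using dist_triangle[of z x c] by linarith
  qed
  have ga: "g a \<in> curve" "g b \<in> curve" using bitangentD by (auto intro: g_in_curve)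
  have seg: "dist w p = infdist w curve"
    if "w \<in> closed_segment z p" "dist z p = infdist z curve" "p \<in> curve" for w p
  proof -
    obtain x where "x \<in> curve" "infdist w curve = dist w x"
      using infdist_attains_inf[OF curve_closed curve_nonempty] by metis
    then show ?thesis using foot[OF that(1,2)] infdist_le[OF that(3), of w] by fastforce
  qed
  show "w \<in> closed_segment z (g a) \<Longrightarrow> dist w (g a) = infdist w curve"
    "w \<in> closed_segment z (g b) \<Longrightarrow> dist w (g b) = infdist w curve"
    using seg ga bitangentD by auto
  show "\<exists>t\<in>{a..b}. dist w (g t) = infdist w curve"
  proof -
    obtain x where x: "x \<in> curve" "infdist w curve = dist w x"
      using infdist_attains_inf[OF curve_closed curve_nonempty] by metis
    have "\<exists>y \<in> g ` {a..b}. dist w y \<le> dist w x"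
    proof (cases "x \<in> g ` {a..b}")
      case False
      then have "x \<notin> closure (pocket a b z)"
        using x(1) bitangentD(2) spokes_Int_curve pocket_subset_domain inside_no_overlap[of curve]
        unfolding closure_pocket by fastforce
      then have "closed_segment w x \<inter> frontier (closure (pocket a b z)) \<noteq> {}"
        using assms by (intro connected_Int_frontier) auto
      moreover have "frontier (closure (pocket a b z)) \<subseteq> g ` {a..b} \<union> spokes a b z"
        using interior_mono[OF closure_subset[of "pocket a b z"]]
        unfolding frontier_pocket[symmetric] frontier_def closure_closure by blast
      ultimately obtain c where c: "c \<in> closed_segment w x" "c \<in> g ` {a..b} \<union> spokes a b z"
        by blast
      have wx: "dist w x = dist w c + dist c x"
        using c(1) by (simp add: between_mem_segment[symmetric] between)
      from c(2) consider "c \<in> g ` {a..b}" | p where "p \<in> {g a, g b}" "c \<in> closed_segment z p"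
        by (auto simp: spokes_def)
      then show ?thesis
      proof cases
        case 1
        then show ?thesis using wx by (intro bexI[of _ c]) auto
      next
        case 2
        then have "dist c p \<le> dist c x" using foot[OF 2(2) _ x(1)] bitangentD by auto
        then have "dist w p \<le> dist w x" using wx dist_triangle[of w p c] by linarith
        moreover have "p \<in> g ` {a..b}" using 2 bitangentD by auto
        ultimately show ?thesis by blast
      qed
    qed auto
    then obtain t where t: "t \<in> {a..b}" "dist w (g t) \<le> dist w x" by blast
    moreover have "infdist w curve \<le> dist w (g t)"
      using t bitangentD by (intro infdist_le g_in_curve) auto
    ultimately show ?thesis using x by auto
  qed
qed

text \<open>If \<open>b - a\<close> were minimal, the parameters of nearest points on the arc would be unique up to the pair
  \<open>a\<close>, \<open>b\<close>: two of them at the same point make this point bitangent, so they are at least as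
  far apart as \<open>a\<close> and \<open>b\<close>.\<close>

lemma bitangent_not_minimal:
  obtains a' b' w where "bitangent a' b' w" "b' - a' < b - a"
proof (rule ccontr)
  assume "\<not> thesis"
  then have minimal: "b - a \<le> t - s" if "bitangent s t w" for s t w
    using that \<open>\<And>a' b' w. bitangent a' b' w \<Longrightarrow> b' - a' < b - a \<Longrightarrow> thesis\<close> by force
  let ?P = "closure (pocket a b z)"
  define K where "K = {k \<in> ?P \<times> {a..b}. dist (fst k) (g (snd k)) = infdist (fst k) curve}"
  \<comment> \<open>The shift by \<open>pi / 2\<close> centres the constant value taken on the spokes, so that the map deviates by at
    most a quarter turn from the parametrization \<open>cis (2 * pi * s)\<close> of the circle.\<close>
  define ang where "ang t = 2 * pi * ((t - a) / (b - a)) - pi / 2" for t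
  have ab: "b - a > 0" using bitangentD by simp
  have "bounded (pocket a b z)"
    using bounded_subset[OF domain_bounded pocket_subset_domain] .
  then have cpt: "compact (?P \<times> {a..b})"
    by (intro compact_Times) (auto simp: compact_eq_bounded_closed)
  have contg: "continuous_on (?P \<times> {a..b}) (\<lambda>k. g (snd k))"
    using bitangentD by (intro continuous_on_compose2[OF continuous_g] continuous_intros) auto
  have "closedin (top_of_set (?P \<times> {a..b})) K"
  proof -
    have "K = (?P \<times> {a..b}) \<inter> (\<lambda>k. dist (fst k) (g (snd k)) - infdist (fst k) curve) -` {0}"
      unfolding K_def by auto
    also have "closedin (top_of_set (?P \<times> {a..b})) \<dots>"
      by (intro continuous_closedin_preimage continuous_intros contg)
    finally show ?thesis .
  qed
  with cpt have "compact K" by (rule closedin_compact)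
  have fst_K: "fst ` K = ?P"
    unfolding K_def using nearest_point_on_arc(1) by force
  have lt: "s = t \<or> s = a \<and> t = b" if st: "(w, s) \<in> K" "(w, t) \<in> K" "s \<le> t" for w s t
  proof (cases "w \<in> curve")
    case True
    then have "g s = g t" using that by (simp add: K_def)
    then show ?thesis using g_inj[of s t] that bitangentD by (auto simp: K_def)
  next
    case False
    have "w \<in> domain"
      using st False closure_mono[OF pocket_subset_domain] by (auto simp: K_def closure_domain)
    then have "bitangent s t w" if "s < t"
      using st that bitangentD by (auto simp: K_def bitangent_def)
    then have "b - a \<le> t - s" if "s < t"
      using minimal that by blast
    then show ?thesis using st by (force simp: K_def)
  qed
  have cis_ab: "cis (ang a) = cis (ang b)"
  proof -
    have "ang b = ang a + 2 * pi" using ab by (simp add: ang_def)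
    then show ?thesis by (simp add: complex_eq_iff)
  qed
  have fibres: "cis (ang (snd k)) = cis (ang (snd l))" if kl: "k \<in> K" "l \<in> K" "fst k = fst l" for k l
  proof -
    obtain w s t where wst: "k = (w, s)" "l = (w, t)" using kl by (metis prod.collapse)
    then have "s = t \<or> s = a \<and> t = b \<or> t = a \<and> s = b"
      using lt[of w s t] lt[of w t s] kl linear[of s t] by auto
    then show ?thesis using wst cis_ab by auto
  qed
  have cont_cis: "continuous_on K (\<lambda>k. cis (ang (snd k)))"
    unfolding ang_def using ab by (intro continuous_intros) auto
  obtain F where contF: "continuous_on (fst ` K) F"
      and F: "\<And>k. k \<in> K \<Longrightarrow> F (fst k) = cis (ang (snd k))"
    by (rule continuous_factor_through_compact[OF \<open>compact K\<close> continuous_on_fst[OF continuous_on_id] cont_cis])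
       (erule (2) fibres, rule that)
  have F': "F w = cis (ang t)" if "w \<in> ?P" "t \<in> {a..b}" "dist w (g t) = infdist w curve" for w t
    using F[of "(w, t)"] that by (simp add: K_def)
  show False
  proof (rule no_extension_near_parametrization[OF simple_rim loop_rim])
    show "continuous_on (closure (inside (path_image rim))) F"
      using contF fst_K by (simp add: pocket_eq_inside_rim)
    show "norm (F w) = 1" if "w \<in> closure (inside (path_image rim))" for w
    proof -
      have "w \<in> fst ` K" using that fst_K by (simp add: pocket_eq_inside_rim)
      then show ?thesis using F by auto
    qed
    show "dist (F (rim s)) (cis (2 * pi * s)) < 2" if s: "s \<in> {0..1}" for s
    proof -
      have in_P: "rim s \<in> ?P"
        using s closure_pocket path_image_rim by (auto simp: path_image_def)
      show ?thesis
      proof (cases "s \<le> 1/2")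
        case True
        define t where "t = a + (b - a) * (2 * s)"
        have rs: "rim s = g t" using True by (simp add: rim_def joinpaths_def subpath_def t_def add.commute)
        have "(b - a) * (2 * s) \<le> (b - a) * 1" using ab True by (intro mult_left_mono) auto
        then have "t \<le> b" by (simp add: t_def)
        moreover have "a \<le> t" using s ab by (simp add: t_def)
        ultimately have t: "t \<in> {a..b}" by simp
        have "g t \<in> curve" using t arc_subset_curve by blast
        then have "F (rim s) = cis (ang t)"
          using F'[OF in_P t] rs by simp
        have "ang t - 2 * pi * s = 2 * pi * s - pi / 2"
          using ab by (simp add: ang_def t_def)
        moreover have "sin (2 * pi * s) \<ge> 0"
          using s True by (intro sin_ge_zero) auto
        moreover have "cos (2 * pi * s - pi / 2) = sin (2 * pi * s)"
          by (simp add: cos_diff)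
        ultimately have "0 \<le> cos (ang t - 2 * pi * s)" by (simp only:)
        then show ?thesis
          unfolding \<open>F (rim s) = cis (ang t)\<close> by (rule dist_cis_less_2)
      next
        case False
        have "rim s \<in> spokes a b z"
          using False s unfolding path_image_spokes_path[symmetric] 
          by (simp add: rim_def joinpaths_def path_image_def)
             (auto intro!: image_eqI[of _ _ "2 * s - 1"])
        then have "F (rim s) = cis (ang a)"
          using F'[OF in_P, of a] F'[OF in_P, of b] nearest_point_on_arc(2,3)[OF in_P] cis_ab ab
          unfolding spokes_def by fastforce
        moreover have "cos (ang a - 2 * pi * s) \<ge> 0"
        proof -
          have "cos (ang a - 2 * pi * s) = sin (2 * pi * s - pi)"
            by (simp add: ang_def cos_diff sin_diff)
          moreover have "0 \<le> sin (2 * pi * s - pi)"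
            using s False by (intro sin_ge_zero) (auto simp: field_simps)
          ultimately show ?thesis by simp
        qed
        ultimately show ?thesis by (simp add: dist_cis_less_2)
      qed
    qed
  qed
qed

end

end

section \<open>The inscribed disc\<close>

context jordan_loop
begin

text \<open>The hypothesis \<open>touching\<close> is the curvature bound \<open>1 / R\<close> for the domain, with the touching arcs
  replaced by the discs that carry them.\<close>

lemma ex_inscribed_disc:
  assumes touching: "\<And>x y \<epsilon>. x \<in> curve \<Longrightarrow> x \<noteq> y \<Longrightarrow> 0 < \<epsilon> \<Longrightarrow>
    domain \<inter> ball x \<epsilon> \<subseteq> cball y (dist y x) \<Longrightarrow> R \<le> dist y x"
  shows "\<exists>z. ball z R \<subseteq> domain"
proof (rule ccontr)
  assume "\<not> ?thesis"
  then have no_disc: "\<not> ball z R \<subseteq> domain" for z by blast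
  then have "R > 0" by (metis ball_empty empty_subsetI not_less)
  have cpt: "compact (closure domain)"
    using domain_bounded by (simp only: compact_closure)
  moreover have "closure domain \<noteq> {}" using domain_nonempty by simp
  moreover have "continuous_on (closure domain) (\<lambda>z. infdist z curve)"
    by (intro continuous_intros)
  ultimately obtain m where m: "m \<in> closure domain"
      "\<And>z. z \<in> closure domain \<Longrightarrow> infdist z curve \<le> infdist m curve"
    using continuous_attains_sup[of "closure domain" "\<lambda>z. infdist z curve"] by blast
  \<comment> \<open>The largest inscribed disc has radius less than \<open>R\<close>: this is the uniform margin \<open>R - infdist m curve\<close>.\<close>
  have "infdist m curve < R"
  proof (cases "m \<in> domain")
    case True
    show ?thesis
    proof (rule ccontr)
      assume "\<not> infdist m curve < R"
      then have "ball m R \<subseteq> ball m (infdist m curve)" by (intro subset_ball) simp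
      then show False using ball_infdist_subset_domain[OF True] no_disc by blast
    qed
  next
    case False
    then have "m \<in> curve" using m(1) closure_domain by blast
    then show ?thesis using \<open>R > 0\<close> by simp
  qed
  then have \<delta>: "0 < R - infdist m curve" by simp
  have "uniformly_continuous_on {0..1} g"
    using continuous_g by (intro compact_uniformly_continuous) auto
  then obtain \<eta> where "\<eta> > 0" and \<eta>: "\<And>s t. s \<in> {0..1} \<Longrightarrow> t \<in> {0..1} \<Longrightarrow> dist s t < \<eta> \<Longrightarrow>
      dist (g s) (g t) < R - infdist m curve"
    using \<delta> unfolding uniformly_continuous_on_def by metis
  have gap: "\<eta> \<le> b - a" if bt: "bitangent a b z" for a b z
  proof -
    obtain t \<epsilon> where t: "t \<in> {a<..<b}" "0 < dist z (g t)" "0 < \<epsilon>"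
        "domain \<inter> ball (g t) \<epsilon> \<subseteq> cball z (dist z (g t))"
      by (rule touching_disc[OF bt])
    note D = bitangentD[OF bt]
    have t01: "t \<in> {0..1}" "a \<in> {0..1}" using t(1) D by auto
    have "R \<le> dist z (g t)"
      using t g_in_curve[OF t01(1)] by (intro touching[of "g t" z \<epsilon>]) auto
    moreover have "infdist z curve \<le> infdist m curve"
      using m(2) D(5) closure_subset by blast
    ultimately have "R - infdist m curve \<le> dist (g a) (g t)"
      using dist_triangle[of z "g t" "g a"] D(6) by linarith
    then have "\<eta> \<le> dist a t" using \<eta>[OF t01(2,1)] by fastforce
    then show ?thesis using t(1) by (auto simp: dist_real_def)
  qed
  obtain a0 b0 z0 where bt0: "bitangent a0 b0 z0" using ex_bitangent by blast
  \<comment> \<open>\<open>S\<close> consists of the bitangent points with \<open>b - a\<close> at most \<open>b0 - a0\<close>. It is compact because \<open>gap\<close> and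
    \<open>b0 - a0 < 1\<close> make the strict inequalities in \<open>bitangent\<close> follow from weak ones.\<close>
  define D where "D = {0..1::real} \<times> {0..1::real} \<times> closure domain"
  define \<Phi> where "\<Phi> = (\<lambda>(a, b, z). (b - a, dist z (g a) - infdist z curve, dist z (g b) - infdist z curve))"
  define S where "S = D \<inter> \<Phi> -` ({\<eta>..b0 - a0} \<times> {0} \<times> {0})"
  have "compact D"
    unfolding D_def using cpt by (intro compact_Times) auto
  moreover have "closedin (top_of_set D) S"
  proof -
    have "continuous_on D \<Phi>"
      unfolding \<Phi>_def D_def case_prod_unfold
      by (intro continuous_intros continuous_on_compose2[OF continuous_g]) auto
    then show ?thesis
      unfolding S_def by (intro continuous_closedin_preimage closed_Times) auto
  qed
  ultimately have "compact S" by (rule closedin_compact)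
  have in_S: "(a, b, z) \<in> S" if "bitangent a b z" "b - a \<le> b0 - a0" for a b z
  proof -
    have "z \<in> closure domain" using bitangentD(5)[OF that(1)] closure_subset by blast
    then show ?thesis
      using that(2) gap[OF that(1)] bitangentD[OF that(1)]
      by (simp add: S_def D_def \<Phi>_def)
  qed
  have "S \<noteq> {}" using in_S[OF bt0] by auto
  moreover have "continuous_on S (\<lambda>k. fst (snd k) - fst k)"
    by (intro continuous_intros)
  ultimately obtain k where k: "k \<in> S" "\<And>l. l \<in> S \<Longrightarrow> fst (snd k) - fst k \<le> fst (snd l) - fst l"
    using continuous_attains_inf[OF \<open>compact S\<close>, of "\<lambda>k. fst (snd k) - fst k"] by blast
  obtain a b z where abz: "k = (a, b, z)" by (metis prod.collapse)
  have *: "0 \<le> a" "b \<le> 1" "\<eta> \<le> b - a" "b - a \<le> b0 - a0" "z \<in> closure domain"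
      "dist z (g a) = infdist z curve" "dist z (g b) = infdist z curve"
    using k(1) by (auto simp: abz S_def D_def \<Phi>_def)
  have lt: "b - a < 1" using *(4) bitangentD(4)[OF bt0] by simp
  have "z \<notin> curve"
  proof
    assume "z \<in> curve"
    then have "g a = g b" using *(6,7) by simp
    then show False using g_inj[of a b] * lt \<open>\<eta> > 0\<close> by simp
  qed
  then have "bitangent a b z"
    using * lt \<open>\<eta> > 0\<close> by (simp add: bitangent_def closure_domain)
  then obtain a' b' w where "bitangent a' b' w" "b' - a' < b - a"
    by (rule bitangent_not_minimal)
  then show False using k(2)[OF in_S] *(4) abz by fastforce
qed

end

section \<open>Transport to the real plane\<close>

lemma image_inside_subset:
  fixes f :: "'a::euclidean_space \<Rightarrow> 'b::euclidean_space"
  assumes "linear f" "linear f'" and inv: "\<And>x. f' (f x) = x" "\<And>y. f (f' y) = y"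
  shows "f ` inside S \<subseteq> inside (f ` S)"
proof
  fix y assume "y \<in> f ` inside S"
  then obtain x where x: "y = f x" "x \<notin> S" "bounded (connected_component_set (- S) x)"
    by (auto simp: inside_def)
  let ?X = "connected_component_set (- f ` S) y"
  have y: "y \<notin> f ` S" using x inv by (metis imageE)
  have "f' ` ?X \<subseteq> connected_component_set (- S) x"
  proof (rule connected_component_maximal)
    show "x \<in> f' ` ?X" using x y inv(1) by (intro image_eqI[of _ _ y]) auto
    show "connected (f' ` ?X)"
      using \<open>linear f'\<close> by (intro connected_linear_image) auto
    show "f' ` ?X \<subseteq> - S"
    proof
      fix v assume "v \<in> f' ` ?X"
      then obtain u where u: "u \<in> ?X" "v = f' u" by blast
      then have "u \<notin> f ` S" using connected_component_subset by blast
      then show "v \<in> - S" using u(2) inv(2) by (metis ComplI imageI)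
    qed
  qed
  then have "bounded (f ` f' ` ?X)"
    using x(3) \<open>linear f\<close>
    by (intro bounded_linear_image[of _ f])
       (auto intro: bounded_subset simp: linear_conv_bounded_linear)
  then have "bounded ?X" by (simp add: image_image inv)
  then show "y \<in> inside (f ` S)" using y by (simp add: inside_def)
qed

text \<open>The half circle centred at \<open>x\<close> is an arc as required. Its relative interior contains the part \<open>T\<close> of
  the circle in an open half plane bounded by a diameter: there the angle from \<open>x - y\<close> to \<open>v - y\<close> is
  less than a right angle, so \<open>arcsin\<close> recovers it from its sine.\<close>

lemma arc_touches_from_outsideI:
  fixes x y :: "real^2"
  assumes "x \<noteq> y" "0 < \<epsilon>" "E \<inter> ball x \<epsilon> \<subseteq> cball y (dist y x)"
  shows "\<exists>A. arc_touches_from_outside A y (dist y x) E x"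
proof -
  let ?r = "dist y x"
  have r: "?r > 0" using assms(1) by simp
  let ?e = "\<lambda>t. vector [cos t, sin t] :: real^2"
  have polar: "\<exists>t. v = y + ?r *\<^sub>R ?e t" if "v \<in> sphere y ?r" for v
  proof -
    have eq: "?r\<^sup>2 = (v $ 1 - y $ 1)\<^sup>2 + (v $ 2 - y $ 2)\<^sup>2"
    proof -
      have "?r = norm (v - y)" using that by (simp add: dist_norm norm_minus_commute)
      then show ?thesis
        by (simp add: norm_vec_def L2_set_def sum_2)
    qed
    have "((v $ 1 - y $ 1) / ?r)\<^sup>2 + ((v $ 2 - y $ 2) / ?r)\<^sup>2 = ?r\<^sup>2 / ?r\<^sup>2"
      by (simp only: eq power_divide add_divide_distrib)
    also have "\<dots> = 1" using r by simp
    finally obtain t where "(v $ 1 - y $ 1) / ?r = cos t" "(v $ 2 - y $ 2) / ?r = sin t"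
      using sincos_total_2pi by metis
    then have "v = y + ?r *\<^sub>R ?e t"
      using r by (simp add: vec_eq_iff forall_2 field_simps)
    then show ?thesis by blast
  qed
  obtain \<theta> where \<theta>: "x = y + ?r *\<^sub>R ?e \<theta>" using polar[of x] by auto
  define A where "A = (\<lambda>t. y + ?r *\<^sub>R ?e t) ` {\<theta> - pi / 2..\<theta> + pi / 2}"
  have "circular_arc A y ?r"
    unfolding circular_arc_def A_def using r pi_gt_zero
    by (intro conjI exI[of _ "\<theta> - pi / 2"] exI[of _ "\<theta> + pi / 2"]) auto
  moreover have "x \<in> top_of_set (sphere y ?r) interior_of A"
  proof -
    define T where "T = sphere y ?r \<inter> {v. (x - y) \<bullet> y < (x - y) \<bullet> v}"
    have "openin (top_of_set (sphere y ?r)) T"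
      unfolding T_def by (intro openin_open_Int) (simp add: open_halfspace_gt)
    moreover have "x \<in> T"
    proof -
      have "0 < (x - y) \<bullet> (x - y)" using assms(1) by simp
      then show ?thesis unfolding T_def by (simp add: inner_diff_right)
    qed
    moreover have "T \<subseteq> A"
    proof
      fix v assume v: "v \<in> T"
      then obtain \<phi> where \<phi>: "v = y + ?r *\<^sub>R ?e \<phi>" using polar by (auto simp: T_def)
      have "0 < (x - y) \<bullet> (v - y)" using v by (simp add: T_def inner_diff_right)
      also have "(x - y) \<bullet> (v - y) = (?r *\<^sub>R ?e \<theta>) \<bullet> (?r *\<^sub>R ?e \<phi>)"
        using \<theta> \<phi> by (metis add_diff_cancel_left')
      also have "\<dots> = ?r * ?r * cos (\<phi> - \<theta>)"
        by (simp add: inner_vec_def sum_2 cos_diff algebra_simps)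
      finally have "0 < cos (\<phi> - \<theta>)" using r by (simp add: zero_less_mult_iff)
      define \<psi> where "\<psi> = arcsin (sin (\<phi> - \<theta>))"
      have sin: "sin \<psi> = sin (\<phi> - \<theta>)" by (simp add: \<psi>_def)
      have "cos \<psi> = sqrt (1 - (sin (\<phi> - \<theta>))\<^sup>2)" by (simp add: \<psi>_def cos_arcsin)
      also have "\<dots> = cos (\<phi> - \<theta>)" using \<open>0 < cos (\<phi> - \<theta>)\<close> by (simp flip: cos_squared_eq)
      finally have cos: "cos \<psi> = cos (\<phi> - \<theta>)" .
      have "?e \<phi> = ?e (\<theta> + \<psi>)"
      proof -
        have "cos (\<theta> + \<psi>) = cos (\<theta> + (\<phi> - \<theta>))" "sin (\<theta> + \<psi>) = sin (\<theta> + (\<phi> - \<theta>))"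
          by (simp_all only: cos_add sin_add sin cos)
        then show ?thesis by simp
      qed
      moreover have "\<theta> + \<psi> \<in> {\<theta> - pi / 2..\<theta> + pi / 2}"
        using arcsin_bounded[of "sin (\<phi> - \<theta>)"] by (simp add: \<psi>_def)
      ultimately show "v \<in> A"
        unfolding A_def using \<phi> by (intro image_eqI[of _ _ "\<theta> + \<psi>"]) simp_all
    qed
    ultimately show ?thesis by (auto simp: interior_of_def)
  qed
  ultimately show ?thesis using assms unfolding arc_touches_from_outside_def by blast
qed

theorem theorem1p6:
  fixes E :: "(real^2) set" and h :: real
  assumes "h > 0"
    and "Jordan_domain E"
    and "visc_curvature_le E h"
  shows "\<exists>z. ball z (1 / h) \<subseteq> E"
proof -
  obtain C where "Jordan_curve C" and E: "E = inside C"
    using assms(2) by (auto simp: Jordan_domain_def)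
  have "DIM(real^2) = DIM(complex)" by simp
  then obtain f :: "real^2 \<Rightarrow> complex" and f' where lin: "linear f" "linear f'"
      and norm_f: "\<And>x. norm (f x) = norm x" and inv: "\<And>x. f' (f x) = x" "\<And>y. f (f' y) = y"
    by (rule isomorphisms_UNIV_UNIV) (rule that)
  have dist_f: "dist (f x) (f y) = dist x y" for x y
    using norm_f[of "x - y"] lin(1) by (simp add: dist_norm linear_diff)
  have cont: "continuous_on S f" "continuous_on T f'" for S T
    using lin by (simp_all add: linear_continuous_on linear_conv_bounded_linear)
  have "f ` C homeomorphic sphere (0::complex) 1"
  proof -
    have "homeomorphism C (f ` C) f f'"
      using cont inv by (simp add: homeomorphism_def image_image)
    moreover have "homeomorphism (sphere 0 1) (sphere 0 1) f f'"
    proof -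
      have norm_f': "norm (f' y) = norm y" for y using norm_f[of "f' y"] inv by simp
      have "f ` sphere 0 1 = sphere 0 1"
      proof
        show "sphere 0 1 \<subseteq> f ` sphere 0 1"
        proof
          fix y :: complex assume "y \<in> sphere 0 1"
          then show "y \<in> f ` sphere 0 1"
            using inv(2) norm_f' by (intro image_eqI[of _ _ "f' y"]) simp_all
        qed
      qed (use norm_f in auto)
      moreover from this have "f' ` sphere 0 1 = sphere 0 1"
        using inv(1) by (metis (no_types, lifting) image_cong image_ident image_image)
      ultimately show ?thesis
        using cont inv by (simp add: homeomorphism_def)
    qed
    ultimately show ?thesis
      using \<open>Jordan_curve C\<close> unfolding Jordan_curve_def
      by (meson homeomorphic_def homeomorphic_sym homeomorphic_trans)
  qed
  then obtain q q' where q: "homeomorphism (sphere (0::complex) 1) (f ` C) q q'"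
    using homeomorphic_sym homeomorphic_def by metis
  define g where "g = (\<lambda>t. q (cis (2 * pi * t)))"
  interpret jordan_loop g
  proof
    have "continuous_on {0..1} g"
      unfolding g_def
      by (intro continuous_on_compose2[OF homeomorphism_cont1[OF q]] continuous_intros) auto
    moreover have "loop_free g"
    proof -
      have "cis (2 * pi * s) = cis (2 * pi * t)" if "g s = g t" for s t
        using that homeomorphism_apply1[OF q] by (metis g_def mem_sphere_0 norm_cis)
      then show ?thesis unfolding loop_free_def using cis_2pi_eq by blast
    qed
    ultimately show "simple_path g" by (simp add: simple_path_def path_def)
    show "pathfinish g = pathstart g"
      by (simp add: g_def pathfinish_def pathstart_def)
  qed
  have curve: "curve = f ` C"
  proof -
    have "curve = q ` (\<lambda>t. cis (2 * pi * t)) ` {0..1}"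
      by (simp add: path_image_def g_def image_image)
    then show ?thesis using homeomorphism_image1[OF q] by (simp add: cis_2pi_image)
  qed
  have domain: "domain = f ` E"
  proof
    show "f ` E \<subseteq> domain"
      unfolding E curve using image_inside_subset[OF lin inv] .
    have "f' ` domain \<subseteq> E"
      using image_inside_subset[OF lin(2,1) inv(2,1), of "f ` C"]
      by (simp add: E curve image_image inv)
    then show "domain \<subseteq> f ` E" using inv(2) by (metis image_eqI image_subset_iff subsetI)
  qed
  have "\<exists>z. ball z (1 / h) \<subseteq> domain"
  proof (rule ex_inscribed_disc)
    fix x y \<epsilon> assume x: "x \<in> curve" "x \<noteq> y" and \<epsilon>: "0 < \<epsilon>"
      and sub: "domain \<inter> ball x \<epsilon> \<subseteq> cball y (dist y x)"
    let ?x = "f' x" and ?y = "f' y"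
    have xy: "dist ?y v = dist y (f v)" "dist ?x v = dist x (f v)" for v
      using dist_f[of ?y v] dist_f[of ?x v] inv by simp_all
    have "?x \<in> frontier E"
    proof -
      have "x \<in> f ` closure E"
        using x(1) frontier_domain domain lin(1) inv(1)
        by (metis closure_injective_linear_image closure_domain Un_iff injI)
      moreover have "x \<notin> f ` E" using x(1) domain inside_no_overlap[of curve] by blast
      ultimately have "?x \<in> closure E" "?x \<notin> E" using inv by (auto simp: image_iff)
      then show ?thesis using interior_subset by (auto simp: frontier_def)
    qed
    moreover have "E \<inter> ball ?x \<epsilon> \<subseteq> cball ?y (dist ?y ?x)"
      using sub by (auto simp: domain xy inv image_iff subset_iff)
    then obtain A where "arc_touches_from_outside A ?y (dist ?y ?x) E ?x"
      using arc_touches_from_outsideI \<epsilon> x(2) inv(2) by metis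
    ultimately have "1 / h \<le> dist ?y ?x"
      using assms(3) unfolding visc_curvature_le_def visc_curvature_le_at_def by blast
    then show "1 / h \<le> dist y x" by (simp add: xy inv)
  qed
  then obtain z where "ball z (1 / h) \<subseteq> f ` E" unfolding domain by blast
  then have "ball (f' z) (1 / h) \<subseteq> E"
    using dist_f inv by (auto simp: subset_iff image_iff) metis
  then show ?thesis by blast
qed

end
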